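(* Let $A,B,C$ be three non-collinear points in the plane with $|AB|<|BC|<|CA|$. Then the three perpendicular bisectors of the sides of the triangle $ABC$ divide the plane into six regions (in cyclic order around the circumcenter) satisfying the following properties: (i) $A$ and $B$ lie in two consecutive regions; (ii) the regions containing $B$ and $C$ are separated by one empty region (i.e. exactly one region, containing none of the three points, lies between them when going around the circumcenter in one of the two directions); (iii) the regions containing $C$ and $A$ are separated by two empty regions (in the same sense). In particular, the equivalence class of $(0,1,0,0,1,1)$ is the only realizable bracelet for $n=3$.
   Context: $|AB|$ denotes Euclidean distance. A region is empty if it contains none of the points $A,B,C$. Realizable bracelets: let $n\ge 3$ and let $P_1,\ldots,P_n$ be $n$ distinct points on the unit circle of the complex plane in counterclockwise cyclic order; let $L_i$ be the perpendicular bisector of $[P_i,P_{i+1}]$ (indices modulo $n$). Assume generic position: the lines $L_i$ are pairwise distinct, no $P_j$ lies on any $L_i$, and the point $1$ lies on no $L_i$. The lines divide the plane into $2n$ regions, numbered counterclockwise starting with the region containing $1$; the occupancy word is $(v_1,\ldots,v_{2n})\in\{0,1\}^{2n}$ where $v_i$ is the number of points $P_j$ in the $i$th region. A word is realizable if it is the occupancy word of some such generic collection. A bracelet is an equivalence class of words up to cyclic shifts and reversal; a realizable bracelet (of length $2n$) is the class of a realizable word. *)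

theory Defs
  imports "HOL-Analysis.Analysis"
begin

definition perp_bisector :: "complex \<Rightarrow> complex \<Rightarrow> complex set" where
  "perp_bisector a b = {z. (z - midpoint a b) \<bullet> (b - a) = 0}"

definition circumcenter :: "complex \<Rightarrow> complex \<Rightarrow> complex \<Rightarrow> complex" where
  "circumcenter a b c = (THE p. dist p a = dist p b \<and> dist p b = dist p c)"

definition regions :: "complex set set \<Rightarrow> complex set set" where
  "regions Ls = components (- \<Union>Ls)"

definition ccw_angles :: "nat \<Rightarrow> (nat \<Rightarrow> real) \<Rightarrow> bool" where
  "ccw_angles m \<theta> \<longleftrightarrow> strict_mono_on {..<m} \<theta> \<and> (\<forall>i<m. \<theta> i < \<theta> 0 + 2 * pi)"

(* Meant for regions cut out by finitely many lines through p. These are open sectors with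
   apex p, so the list is determined up to rotation by asking that a ray from p inside each
   listed region be met in counterclockwise order within a single turn. *)
definition ccw_numbering :: "complex \<Rightarrow> complex set set \<Rightarrow> complex set list \<Rightarrow> bool" where
  "ccw_numbering p \<R> Rs \<longleftrightarrow> distinct Rs \<and> set Rs = \<R> \<and>
     (\<exists>\<theta>. ccw_angles (length Rs) \<theta> \<and> (\<forall>i<length Rs. \<forall>r>0. p + rcis r (\<theta> i) \<in> Rs ! i))"

(* Positions in Rs are cyclic. Going around in one of the two directions, exactly k regions,
   all disjoint from S, lie between the region of x and that of y; for k = 0 the two regions
   are consecutive. *)
definition separated_by_empty ::
    "nat \<Rightarrow> complex set \<Rightarrow> complex set list \<Rightarrow> complex \<Rightarrow> complex \<Rightarrow> bool" where
  "separated_by_empty k S Rs x y \<longleftrightarrow>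
     (\<exists>i<length Rs. \<exists>j<length Rs. j = (i + k + 1) mod length Rs \<and>
        (x \<in> Rs ! i \<and> y \<in> Rs ! j \<or> y \<in> Rs ! i \<and> x \<in> Rs ! j) \<and>
        (\<forall>t\<in>{1..k}. Rs ! ((i + t) mod length Rs) \<inter> S = {}))"

(* The points are P 0, ..., P (n - 1). *)
definition ccw_on_unit_circle :: "nat \<Rightarrow> (nat \<Rightarrow> complex) \<Rightarrow> bool" where
  "ccw_on_unit_circle n P \<longleftrightarrow> (\<exists>\<theta>. ccw_angles n \<theta> \<and> (\<forall>i<n. P i = cis (\<theta> i)))"

definition bisector :: "nat \<Rightarrow> (nat \<Rightarrow> complex) \<Rightarrow> nat \<Rightarrow> complex set" where
  "bisector n P i = perp_bisector (P i) (P (Suc i mod n))"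

definition generic :: "nat \<Rightarrow> (nat \<Rightarrow> complex) \<Rightarrow> bool" where
  "generic n P \<longleftrightarrow> inj_on (bisector n P) {..<n} \<and>
     (\<forall>i<n. \<forall>j<n. P j \<notin> bisector n P i) \<and> (\<forall>i<n. 1 \<notin> bisector n P i)"

definition occupancy_word :: "nat \<Rightarrow> (nat \<Rightarrow> complex) \<Rightarrow> nat list \<Rightarrow> bool" where
  "occupancy_word n P w \<longleftrightarrow>
     (\<exists>Rs. ccw_numbering 0 (regions (bisector n P ` {..<n})) Rs \<and> 1 \<in> Rs ! 0 \<and>
        w = map (\<lambda>R. card {j. j < n \<and> P j \<in> R}) Rs)"

(* In generic position w has length 2 * n and entries in {0, 1}, since consecutive points
   P i and P (Suc i mod n) lie on different sides of their bisector. *)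
definition realizable :: "nat \<Rightarrow> nat list \<Rightarrow> bool" where
  "realizable n w \<longleftrightarrow> n \<ge> 3 \<and>
     (\<exists>P. ccw_on_unit_circle n P \<and> generic n P \<and> occupancy_word n P w)"

definition bracelet_equiv :: "'a list \<Rightarrow> 'a list \<Rightarrow> bool" where
  "bracelet_equiv = equivclp (\<lambda>u v. v = rotate1 u \<or> v = rev u)"

definition bracelet :: "'a list \<Rightarrow> 'a list set" where
  "bracelet w = {v. bracelet_equiv w v}"

definition realizable_bracelets :: "nat \<Rightarrow> nat list set set" where
  "realizable_bracelets n = bracelet ` {w. realizable n w}"

end

theory Submission imports Defs begin

text \<open>Comparing the distances from a point to \<open>A\<close>, \<open>B\<close>, \<open>C\<close> gives a triple of signs, which is constant
  on each region and takes exactly the six non-constant values. Along a circle around the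
  circumcenter each sign is the sign of a sinusoid and changes only twice per turn, so consecutive
  regions differ in exactly one sign. This determines the cyclic order up to reversal, and the side
  lengths determine the triples of the three vertices. On the unit circle, genericity forces the
  triangle to be scalene, because a vertex lies off the bisector of the opposite side.\<close>

text \<open>A numbering is known only through its list and one ray angle per region, increasing
  within a turn; angles of bisectors are never computed. The sinusoid therefore enters through four
  samples: alternating signs \<open>+ - + -\<close> within less than a turn are impossible. What
  remains is finite combinatorics of six sign triples. The comparisons run cyclically, along
  \<open>B - A\<close>, \<open>C - B\<close>, \<open>A - C\<close>, because these normals add up to
  zero; this is what excludes exactly the two constant triples. In the resulting six-cycle
  complementary triples are opposite. Those of \<open>A\<close> and \<open>C\<close> are
  complementary, those of \<open>A\<close> and \<open>B\<close> differ in one sign, and this fixes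
  all gaps. Statements about every numbering say little unless one exists, and a set of bracelets is
  a singleton only if some word is realizable, so both existence claims need their own
  constructions.\<close>

section \<open>Perpendicular bisectors and the circumcenter\<close>

lemma mem_perp_bisector_iff: "z \<in> perp_bisector a b \<longleftrightarrow> dist z a = dist z b"
proof -
  have "(dist z a)\<^sup>2 - (dist z b)\<^sup>2 = 2 * ((z - midpoint a b) \<bullet> (b - a))"
    unfolding dist_norm power2_norm_eq_inner midpoint_def
    by (simp add: inner_complex_def algebra_simps) (simp add: field_simps)
  moreover have "dist z a = dist z b \<longleftrightarrow> (dist z a)\<^sup>2 - (dist z b)\<^sup>2 = 0"
    by (simp add: power2_eq_iff_nonneg)
  ultimately have "(z - midpoint a b) \<bullet> (b - a) = 0 \<longleftrightarrow> dist z a = dist z b"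
    by (simp only:) simp
  then show ?thesis
    by (simp add: perp_bisector_def)
qed

lemma perp_bisector_commute: "perp_bisector a b = perp_bisector b a"
  by (auto simp: mem_perp_bisector_iff)

lemma perp_bisector_through:
  assumes "dist p a = dist p b"
  shows "perp_bisector a b = {z. (z - p) \<bullet> (b - a) = 0}"
proof -
  have "(p - midpoint a b) \<bullet> (b - a) = 0"
    using assms mem_perp_bisector_iff[of p a b] by (simp add: perp_bisector_def)
  then show ?thesis
    by (auto simp: perp_bisector_def inner_diff_left)
qed

text \<open>The quadratic terms of the two squared distances cancel, so their difference is affine
  in \<open>z\<close>. It vanishes at the equidistant point \<open>p\<close>, which leaves twice the
  inner product.\<close>

lemma inner_pos_iff_closer:
  fixes p :: complex
  assumes "dist p a = dist p b"
  shows "0 < (z - p) \<bullet> (b - a) \<longleftrightarrow> dist z b < dist z a"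
proof -
  have "(dist z a)\<^sup>2 - (dist z b)\<^sup>2 - ((dist p a)\<^sup>2 - (dist p b)\<^sup>2) = 2 * ((z - p) \<bullet> (b - a))"
    unfolding dist_norm power2_norm_eq_inner
    by (simp add: inner_complex_def algebra_simps)
  then have "(dist z a)\<^sup>2 - (dist z b)\<^sup>2 = 2 * ((z - p) \<bullet> (b - a))"
    using assms by simp
  moreover have "dist z b < dist z a \<longleftrightarrow> (dist z b)\<^sup>2 < (dist z a)\<^sup>2"
    by (meson linorder_not_less power_less_imp_less_base power_strict_mono zero_le_dist pos2)
  ultimately show ?thesis
    by linarith
qed

text \<open>\<open>Im (cnj m * n)\<close> is the determinant of the pair \<open>m\<close>,
  \<open>n\<close>, and the witness is Cramer's rule. It serves both to find the circumcenter and to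
  find a point with prescribed signs.\<close>

lemma inner_system_solvable:
  assumes "Im (cnj m * n) \<noteq> 0"
  obtains d :: complex where "d \<bullet> m = x" "d \<bullet> n = y"
proof
  define D where "D = Re m * Im n - Im m * Re n"
  have D: "D \<noteq> 0" using assms by (simp add: D_def)
  let ?d = "Complex ((x * Im n - y * Im m) / D) ((y * Re m - x * Re n) / D)"
  show "?d \<bullet> m = x"
    using D by (simp add: inner_complex_def divide_simps) (simp add: D_def algebra_simps)
  show "?d \<bullet> n = y"
    using D by (simp add: inner_complex_def divide_simps) (simp add: D_def algebra_simps)
qed

lemma inner_system_unique:
  assumes "Im (cnj m * n) \<noteq> 0" "d \<bullet> m = 0" "d \<bullet> n = (0::real)"
  shows "d = 0"
proof -
  have "Re d * Re m + Im d * Im m = 0" "Re d * Re n + Im d * Im n = 0"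
    using assms by (simp_all add: inner_complex_def)
  moreover have "Re m * Im n - Im m * Re n \<noteq> 0" using assms by simp
  ultimately have "Re d = 0 \<and> Im d = 0" by algebra
  then show ?thesis by (simp add: complex_eq_iff)
qed

lemma not_collinear_cross:
  assumes "\<not> collinear {a, b, c :: complex}"
  shows "Im (cnj (b - a) * (c - b)) \<noteq> 0"
proof
  assume *: "Im (cnj (b - a) * (c - b)) = 0"
  have "collinear {0, b - a, c - b}"
  proof -
    have "Im ((c - b) / (b - a)) = 0"
      using * by (simp add: Im_divide algebra_simps)
    then show ?thesis
      by (simp add: collinear_iff_Reals complex_is_Real_iff)
  qed
  then obtain k where "b = a \<or> c = b \<or> c - b = k *\<^sub>R (b - a)"
    by (auto simp: collinear_lemma)
  then have "collinear {0, a - b, c - b}"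
    by (auto simp: collinear_lemma intro: exI[of _ "-k"] simp: algebra_simps)
  then show False
    using assms by (simp add: collinear_3)
qed

text \<open>As a definite description, \<open>circumcenter\<close> yields facts only once existence
  and uniqueness are known; both follow from the independence of the normals \<open>b - a\<close>
  and \<open>c - b\<close>. The third fact identifies the origin as circumcenter on the unit
  circle.\<close>

lemma circumcenter_equidistant:
  assumes "\<not> collinear {a, b, c}"
  defines "p \<equiv> circumcenter a b c"
  shows "dist p a = dist p b" "dist p b = dist p c"
    and "\<And>q. dist q a = dist q b \<Longrightarrow> dist q b = dist q c \<Longrightarrow> p = q"
proof -
  note cr = not_collinear_cross[OF assms(1)]
  have "\<exists>!q. dist q a = dist q b \<and> dist q b = dist q c"
  proof (rule ex_ex1I)
    obtain q where "q \<bullet> (b - a) = midpoint a b \<bullet> (b - a)" "q \<bullet> (c - b) = midpoint b c \<bullet> (c - b)"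
      by (rule inner_system_solvable[OF cr])
    then have "q \<in> perp_bisector a b" "q \<in> perp_bisector b c"
      by (simp_all add: perp_bisector_def inner_diff_left)
    then show "\<exists>q. dist q a = dist q b \<and> dist q b = dist q c"
      unfolding mem_perp_bisector_iff by blast
  next
    fix r q assume r: "dist r a = dist r b \<and> dist r b = dist r c"
      and q: "dist q a = dist q b \<and> dist q b = dist q c"
    then have "r \<in> perp_bisector a b" "r \<in> perp_bisector b c"
      by (simp_all add: mem_perp_bisector_iff)
    then have "(r - q) \<bullet> (b - a) = 0" "(r - q) \<bullet> (c - b) = 0"
      using q by (simp_all add: perp_bisector_through[of q])
    then show "r = q"
      using inner_system_unique[OF cr, of "r - q"] by simp
  qed
  from theI'[OF this] this show "dist p a = dist p b" "dist p b = dist p c"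
    "\<And>q. dist q a = dist q b \<Longrightarrow> dist q b = dist q c \<Longrightarrow> p = q"
    unfolding p_def circumcenter_def by blast+
qed

section \<open>Components of the complement of hyperplanes through a point\<close>

definition hyperplanes_through :: "'a::real_inner \<Rightarrow> 'a set \<Rightarrow> 'a set set" where
  "hyperplanes_through p N = (\<lambda>n. {z. (z - p) \<bullet> n = 0}) ` N"

lemma off_hyperplanes_iff: "z \<notin> \<Union>(hyperplanes_through p N) \<longleftrightarrow> (\<forall>n\<in>N. (z - p) \<bullet> n \<noteq> 0)"
  by (auto simp: hyperplanes_through_def)

text \<open>Points with the same signs as \<open>z\<close> form an intersection of open half-spaces,
  which is convex and hence lies in the component. Conversely, two signs of one inner product on the
  connected component would force a zero, that is, a point on a hyperplane.\<close>

lemma connected_component_off_hyperplanes: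
  fixes p :: "'a::euclidean_space"
  assumes "z \<notin> \<Union>(hyperplanes_through p N)"
  shows "connected_component_set (- \<Union>(hyperplanes_through p N)) z =
    {w. w \<notin> \<Union>(hyperplanes_through p N) \<and> (\<forall>n\<in>N. 0 < (w - p) \<bullet> n \<longleftrightarrow> 0 < (z - p) \<bullet> n)}"
    (is "?C = ?R")
proof
  have R_eq: "?R = (\<Inter>n\<in>N. if 0 < (z - p) \<bullet> n then {w. n \<bullet> w > n \<bullet> p} else {w. n \<bullet> w < n \<bullet> p})"
  proof (rule set_eqI)
    fix w
    have "(w - p) \<bullet> n \<noteq> 0 \<and> (0 < (w - p) \<bullet> n \<longleftrightarrow> 0 < (z - p) \<bullet> n) \<longleftrightarrow>
        w \<in> (if 0 < (z - p) \<bullet> n then {w. n \<bullet> w > n \<bullet> p} else {w. n \<bullet> w < n \<bullet> p})" for n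
      by (simp add: inner_diff_left inner_commute[of n]) linarith
    then show "w \<in> ?R \<longleftrightarrow>
        w \<in> (\<Inter>n\<in>N. if 0 < (z - p) \<bullet> n then {w. n \<bullet> w > n \<bullet> p} else {w. n \<bullet> w < n \<bullet> p})"
      unfolding mem_Collect_eq off_hyperplanes_iff ball_conj_distrib[symmetric] INT_iff by simp
  qed
  have "convex ?R"
    unfolding R_eq by (intro convex_INT) (simp add: convex_halfspace_lt convex_halfspace_gt)
  then show "?R \<subseteq> ?C"
    using assms by (intro connected_component_maximal convex_connected) auto
  show "?C \<subseteq> ?R"
  proof
    fix w assume w: "w \<in> ?C"
    have sub: "?C \<subseteq> - \<Union>(hyperplanes_through p N)"
      by (rule connected_component_subset)
    have "0 < (w - p) \<bullet> n \<longleftrightarrow> 0 < (z - p) \<bullet> n" if n: "n \<in> N" for n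
    proof (rule ccontr)
      assume neg: "\<not> ?thesis"
      let ?I = "(\<lambda>u. (u - p) \<bullet> n) ` ?C"
      have "connected ?I"
        by (intro connected_continuous_image continuous_intros connected_connected_component)
      moreover have "(w - p) \<bullet> n \<in> ?I" "(z - p) \<bullet> n \<in> ?I"
        using w assms by (auto simp: connected_component_refl)
      ultimately have "0 \<in> ?I"
        using neg connectedD_interval[of ?I "(w - p) \<bullet> n" "(z - p) \<bullet> n" 0]
          connectedD_interval[of ?I "(z - p) \<bullet> n" "(w - p) \<bullet> n" 0]
        by (auto simp del: image_iff simp: not_less)
      then obtain u where "u \<in> ?C" "(u - p) \<bullet> n = 0" by auto
      then show False
        using sub n by (auto simp: hyperplanes_through_def)
    qed
    then show "w \<in> ?R" using w sub by auto
  qed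
qed

section \<open>Sign changes of a sinusoid within one turn\<close>

text \<open>Alternating signs force zeros \<open>z1 < z2 < z3\<close> in between. Zeros of the
  cosine are odd multiples of \<open>pi / 2\<close>, so \<open>z3 - z1\<close> is at least
  \<open>2 * pi\<close>, whereas \<open>t1 \<le> z1\<close> and \<open>z3 \<le> t4\<close> keep it
  below \<open>2 * pi\<close>.\<close>

lemma no_cos_alternation:
  fixes t1 t2 t3 t4 :: real
  assumes "t1 < t2" "t2 < t3" "t3 < t4" "t4 < t1 + 2 * pi"
    and "cos t1 > 0" "cos t2 < 0" "cos t3 > 0" "cos t4 < 0"
  shows False
proof -
  obtain z1 where z1: "t1 \<le> z1" "z1 \<le> t2" "cos z1 = 0"
    using IVT2[of cos t2 0 t1] assms by fastforce
  obtain z2 where z2: "t2 \<le> z2" "z2 \<le> t3" "cos z2 = 0"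
    using IVT[of cos t2 0 t3] assms by fastforce
  obtain z3 where z3: "t3 \<le> z3" "z3 \<le> t4" "cos z3 = 0"
    using IVT2[of cos t4 0 t3] assms by fastforce
  obtain i1 i2 i3 :: int where i: "odd i1" "z1 = i1 * (pi / 2)" "odd i2" "z2 = i2 * (pi / 2)"
    "odd i3" "z3 = i3 * (pi / 2)"
    using z1(3) z2(3) z3(3) unfolding cos_zero_iff_int by blast
  have "z1 \<noteq> t2" "z2 \<noteq> t3" "z1 \<noteq> t1"
    using z1 z2 assms by auto
  then have "z1 < z2" "z2 < z3" "z3 < z1 + 4 * (pi / 2)"
    using z1 z2 z3 assms by linarith+
  then have "real_of_int i1 * (pi / 2) < i2 * (pi / 2)" "real_of_int i2 * (pi / 2) < i3 * (pi / 2)"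
    "real_of_int i3 * (pi / 2) < (i1 + 4) * (pi / 2)"
    unfolding i by (simp_all add: algebra_simps)
  then have "i1 < i2" "i2 < i3" "i3 < i1 + 4"
    by (simp_all only: mult_less_cancel_right_pos pi_half_gt_zero of_int_less_iff)
  with i show False by presburger
qed

lemma no_inner_cis_alternation:
  assumes "t1 < t2" "t2 < t3" "t3 < t4" "t4 < t1 + 2 * pi"
    and "cis t1 \<bullet> n > 0" "cis t2 \<bullet> n < 0" "cis t3 \<bullet> n > 0" "cis t4 \<bullet> n < 0"
  shows False
proof -
  have "cis t \<bullet> n = norm n * cos (t - Arg n)" for t
  proof -
    have "cis t \<bullet> rcis (norm n) (Arg n) = norm n * cos (t - Arg n)"
      by (simp add: rcis_def inner_complex_def cos_diff algebra_simps)
    then show ?thesis by (simp add: rcis_cmod_Arg)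
  qed
  then show False
    using assms no_cos_alternation[of "t1 - Arg n" "t2 - Arg n" "t3 - Arg n" "t4 - Arg n"]
    by (auto simp: zero_less_mult_iff mult_less_0_iff)
qed

lemma no_inner_cis_alternation':
  assumes "t1 < t2" "t2 < t3" "t3 < t4" "t4 < t1 + 2 * pi"
    and "cis t1 \<bullet> n < 0" "cis t2 \<bullet> n > 0" "cis t3 \<bullet> n < 0" "cis t4 \<bullet> n > 0"
  shows False
  using no_inner_cis_alternation[of t1 t2 t3 t4 "- n"] assms by simp

section \<open>Cyclic arrangements of six sign triples\<close>

definition mixed_signs :: "(bool \<times> bool \<times> bool) set" where
  "mixed_signs = - {(True,True,True),(False,False,False)}"

text \<open>This says "at most two sign changes around a cycle of six" without cyclic neighbours, in
  the form that increasing angles within a turn deliver directly.\<close>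

definition nonalternating :: "(nat \<Rightarrow> bool) \<Rightarrow> bool" where
  "nonalternating u \<longleftrightarrow> (\<forall>i j k l. i < j \<longrightarrow> j < k \<longrightarrow> k < l \<longrightarrow> l < 6 \<longrightarrow>
     \<not> (u i \<noteq> u j \<and> u j \<noteq> u k \<and> u k \<noteq> u l))"

text \<open>All fifteen four-element subsets of the indices are spelled out, so that a case split
  over the six values can use them.\<close>

lemma nonalternating_quadruples: "nonalternating u \<Longrightarrow>
  \<not> (u 0 \<noteq> u 1 \<and> u 1 \<noteq> u 2 \<and> u 2 \<noteq> u 3) \<and>
  \<not> (u 0 \<noteq> u 1 \<and> u 1 \<noteq> u 2 \<and> u 2 \<noteq> u 4) \<and>
  \<not> (u 0 \<noteq> u 1 \<and> u 1 \<noteq> u 2 \<and> u 2 \<noteq> u 5) \<and>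
  \<not> (u 0 \<noteq> u 1 \<and> u 1 \<noteq> u 3 \<and> u 3 \<noteq> u 4) \<and>
  \<not> (u 0 \<noteq> u 1 \<and> u 1 \<noteq> u 3 \<and> u 3 \<noteq> u 5) \<and>
  \<not> (u 0 \<noteq> u 1 \<and> u 1 \<noteq> u 4 \<and> u 4 \<noteq> u 5) \<and>
  \<not> (u 0 \<noteq> u 2 \<and> u 2 \<noteq> u 3 \<and> u 3 \<noteq> u 4) \<and>
  \<not> (u 0 \<noteq> u 2 \<and> u 2 \<noteq> u 3 \<and> u 3 \<noteq> u 5) \<and>
  \<not> (u 0 \<noteq> u 2 \<and> u 2 \<noteq> u 4 \<and> u 4 \<noteq> u 5) \<and>
  \<not> (u 0 \<noteq> u 3 \<and> u 3 \<noteq> u 4 \<and> u 4 \<noteq> u 5) \<and>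
  \<not> (u 1 \<noteq> u 2 \<and> u 2 \<noteq> u 3 \<and> u 3 \<noteq> u 4) \<and>
  \<not> (u 1 \<noteq> u 2 \<and> u 2 \<noteq> u 3 \<and> u 3 \<noteq> u 5) \<and>
  \<not> (u 1 \<noteq> u 2 \<and> u 2 \<noteq> u 4 \<and> u 4 \<noteq> u 5) \<and>
  \<not> (u 1 \<noteq> u 3 \<and> u 3 \<noteq> u 4 \<and> u 4 \<noteq> u 5) \<and>
  \<not> (u 2 \<noteq> u 3 \<and> u 3 \<noteq> u 4 \<and> u 4 \<noteq> (u (5::nat)::bool))"
  unfolding nonalternating_def by (intro conjI; simp)

lemma sum_lessThan_6: "(\<Sum>i<6. f i) = f 0 + f 1 + f 2 + f 3 + f 4 + (f 5 :: nat)" for f :: "nat \<Rightarrow> nat"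
  by (simp add: eval_nat_numeral)

text \<open>The number of changes around a cycle is even. More than two would thus be at least four,
  and four changes exhibit an alternating quadruple.\<close>

lemma nonalternating_changes_le_2:
  assumes "nonalternating u"
  shows "(\<Sum>i<6. of_bool (u i \<noteq> u ((i + 1) mod 6))) \<le> (2 :: nat)"
proof -
  have mods: "(0 + 1) mod 6 = (1 :: nat)" "(1 + 1) mod 6 = (2 :: nat)" "(2 + 1) mod 6 = (3 :: nat)"
    "(3 + 1) mod 6 = (4 :: nat)" "(4 + 1) mod 6 = (5 :: nat)" "(5 + 1) mod 6 = (0 :: nat)"
    by simp_all
  have "(\<Sum>i<6. of_bool (u i \<noteq> u ((i + 1) mod 6))) = of_bool (u 0 \<noteq> u 1) + of_bool (u 1 \<noteq> u 2) +
      of_bool (u 2 \<noteq> u 3) + of_bool (u 3 \<noteq> u 4) + of_bool (u 4 \<noteq> u 5) + (of_bool (u 5 \<noteq> u 0) :: nat)"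
    unfolding sum_lessThan_6 mods by (rule refl)
  also have "\<dots> \<le> 2"
    using nonalternating_quadruples[OF assms]
    by (cases "u 0"; cases "u 1"; cases "u 2"; cases "u 3"; cases "u 4"; cases "u 5"; simp)
  finally show ?thesis .
qed

lemma add_mod_left_cancel:
  fixes a i j n :: nat
  assumes "(a + i) mod n = (a + j) mod n" "i < n" "j < n"
  shows "i = j"
proof -
  have "j \<le> i" if "(a + i) mod n = (a + j) mod n" "j < n" for i j
  proof (rule ccontr)
    assume "\<not> j \<le> i"
    then have "n dvd j - i"
      using mod_eq_dvd_iff_nat[of "a + i" "a + j" n] that by simp
    then show False
      using \<open>\<not> j \<le> i\<close> that(2) dvd_imp_le[of n "j - i"] by linarith
  qed
  from this[of i j] this[of j i] assms show ?thesis by simp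
qed

text \<open>Each coordinate changes at most twice along the cycle, and each of the six steps changes at least
  one coordinate, so every step changes exactly one: the triples run along a six-cycle.\<close>

lemma sign_triples_arrangement:
  fixes u v w :: "nat \<Rightarrow> bool"
  assumes "nonalternating u" "nonalternating v" "nonalternating w"
   and cst: "\<forall>i<6. u i \<noteq> v i \<or> v i \<noteq> w i"
   and inj: "\<And>i j. i < 6 \<Longrightarrow> j < 6 \<Longrightarrow> u i = u j \<Longrightarrow> v i = v j \<Longrightarrow> w i = w j \<Longrightarrow> i = j"
   and a: "a < 6" "\<not> u a" "\<not> v a" "w a"
  shows "u ((a+3) mod 6)" "v ((a+3) mod 6)" "\<not> w ((a+3) mod 6)"
   "u ((a+1) mod 6) \<and> \<not> v ((a+1) mod 6) \<and> w ((a+1) mod 6) \<or>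
    u ((a+5) mod 6) \<and> \<not> v ((a+5) mod 6) \<and> w ((a+5) mod 6)"
proof -
  let ?c = "\<lambda>i. of_bool (u i \<noteq> u ((i + 1) mod 6)) + of_bool (v i \<noteq> v ((i + 1) mod 6))
    + of_bool (w i \<noteq> w ((i + 1) mod 6)) :: nat"
  have "(\<Sum>i<6. ?c i) \<le> 6"
    unfolding sum.distrib using assms(1-3)[THEN nonalternating_changes_le_2] by linarith
  moreover have ge: "?c i \<ge> 1" if "i < 6" for i
  proof -
    have "(i + 1) mod 6 \<noteq> i" using that by presburger
    then have "u i \<noteq> u ((i + 1) mod 6) \<or> v i \<noteq> v ((i + 1) mod 6) \<or> w i \<noteq> w ((i + 1) mod 6)"
      using inj[of i "(i + 1) mod 6"] that by auto
    then show ?thesis by auto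
  qed
  ultimately have one: "?c i = 1" if "i < 6" for i
  proof -
    have "(\<Sum>j\<in>{..<6}-{i}. ?c j) \<ge> (\<Sum>j\<in>{..<6}-{i}. 1)"
      using ge by (intro sum_mono) auto
    moreover have "(\<Sum>j<6. ?c j) = ?c i + (\<Sum>j\<in>{..<6}-{i}. ?c j)"
      using that by (intro sum.remove) auto
    ultimately show ?thesis
      using \<open>(\<Sum>i<6. ?c i) \<le> 6\<close> ge[OF that] that by simp
  qed
  define T where "T k = (u ((a + k) mod 6), v ((a + k) mod 6), w ((a + k) mod 6))" for k
  define adjacent where "adjacent s t = (case s of (u, v, w) \<Rightarrow> case t of (u', v', w') \<Rightarrow>
     t \<noteq> (True, True, True) \<and> t \<noteq> (False, False, False) \<and>
     of_bool (u \<noteq> u') + of_bool (v \<noteq> v') + of_bool (w \<noteq> w') = (1::nat))" for s t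
  have adjacent: "adjacent (T k) (T (Suc k))" for k
    using one[of "(a + k) mod 6"] cst[rule_format, of "(a + Suc k) mod 6"]
    unfolding T_def adjacent_def by (auto simp: mod_Suc_eq)
  have distinct_T: "T i \<noteq> T j" if "i < j" "j < 6" for i j
  proof
    assume "T i = T j"
    then have "(a + i) mod 6 = (a + j) mod 6"
      unfolding T_def by (intro inj) auto
    then show False
      using add_mod_left_cancel[of a i 6 j] that by simp
  qed
  \<comment> \<open>The cube graph without two opposite vertices is a hexagon, so each remaining
    triple has exactly two neighbours. Since \<open>distinct_T\<close> forbids stepping back, the
    first step of the walk \<open>T\<close> determines all the others.\<close>
  have adjacent_A: "adjacent (False, False, True) t \<Longrightarrow> t = (True, False, True) \<or> t = (False, True, True)" for t
    by (cases t) (auto simp: adjacent_def of_bool_def split: if_splits)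
  have adjacent_B: "adjacent (True, False, True) t \<Longrightarrow> t = (False, False, True) \<or> t = (True, False, False)" for t
    by (cases t) (auto simp: adjacent_def of_bool_def split: if_splits)
  have adjacent_D: "adjacent (False, True, True) t \<Longrightarrow> t = (False, False, True) \<or> t = (False, True, False)" for t
    by (cases t) (auto simp: adjacent_def of_bool_def split: if_splits)
  have adjacent_A': "adjacent (True, True, False) t \<Longrightarrow> t = (False, True, False) \<or> t = (True, False, False)" for t
    by (cases t) (auto simp: adjacent_def of_bool_def split: if_splits)
  have adjacent_B': "adjacent (False, True, False) t \<Longrightarrow> t = (True, True, False) \<or> t = (False, True, True)" for t
    by (cases t) (auto simp: adjacent_def of_bool_def split: if_splits)
  have adjacent_D': "adjacent (True, False, False) t \<Longrightarrow> t = (True, True, False) \<or> t = (True, False, True)" for t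
    by (cases t) (auto simp: adjacent_def of_bool_def split: if_splits)
  have T0: "T 0 = (False, False, True)" using a by (simp add: T_def)
  have "T 1 = (True, False, True) \<or> T 1 = (False, True, True)"
    using adjacent_A[of "T 1"] adjacent[of 0] T0 by simp
  then have "T 3 = (True, True, False) \<and> (T 1 = (True, False, True) \<or> T 5 = (True, False, True))"
  proof
    assume T1: "T 1 = (True, False, True)"
    then have T2: "T 2 = (True, False, False)"
      using adjacent_B[of "T 2"] adjacent[of 1] distinct_T[of 0 2] T0 by (auto simp: numeral_2_eq_2)
    then have "T 3 = (True, True, False)"
      using adjacent_D'[of "T 3"] adjacent[of 2] distinct_T[of 1 3] T1 by auto
    with T1 show ?thesis by blast
  next
    \<comment> \<open>In this direction \<open>(True, False, True)\<close> is the last triple before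
      the walk closes, so it has to be followed up to \<open>T 5\<close>.\<close>
    assume T1: "T 1 = (False, True, True)"
    then have T2: "T 2 = (False, True, False)"
      using adjacent_D[of "T 2"] adjacent[of 1] distinct_T[of 0 2] T0 by (auto simp: numeral_2_eq_2)
    then have T3: "T 3 = (True, True, False)"
      using adjacent_B'[of "T 3"] adjacent[of 2] distinct_T[of 1 3] T1 by auto
    then have T4: "T 4 = (True, False, False)"
      using adjacent_A'[of "T 4"] adjacent[of 3] distinct_T[of 2 4] T2 by auto
    then have "T 5 = (True, False, True)"
      using adjacent_D'[of "T 5"] adjacent[of 4] distinct_T[of 3 5] T3 by auto
    with T3 show ?thesis by blast
  qed
  then show "u ((a+3) mod 6)" "v ((a+3) mod 6)" "\<not> w ((a+3) mod 6)"
   "u ((a+1) mod 6) \<and> \<not> v ((a+1) mod 6) \<and> w ((a+1) mod 6) \<or>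
    u ((a+5) mod 6) \<and> \<not> v ((a+5) mod 6) \<and> w ((a+5) mod 6)"
    by (auto simp: T_def)
qed

section \<open>Existence of a counterclockwise numbering\<close>

text \<open>Each region is a cone with apex \<open>p\<close> and thus contains a whole ray. Choosing
  one angle per region in a window of one turn and sorting the regions by it gives the list.\<close>

lemma ccw_numbering_exists:
  assumes fin: "finite \<R>" and ne: "\<And>R. R \<in> \<R> \<Longrightarrow> R \<noteq> {}"
    and disj: "\<And>R R' z. R \<in> \<R> \<Longrightarrow> R' \<in> \<R> \<Longrightarrow> z \<in> R \<Longrightarrow> z \<in> R' \<Longrightarrow> R = R'"
    and cone: "\<And>R z r. R \<in> \<R> \<Longrightarrow> z \<in> R \<Longrightarrow> r > 0 \<Longrightarrow> p + of_real r * (z - p) \<in> R"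
    and p: "p \<notin> \<Union>\<R>" and z0: "z0 \<in> \<Union>\<R>"
  shows "\<exists>Rs. ccw_numbering p \<R> Rs \<and> z0 \<in> Rs ! 0"
proof -
  define t0 where "t0 = Arg (z0 - p)"
  define ray where "ray \<theta> R \<longleftrightarrow> (\<forall>r>0. p + rcis r \<theta> \<in> R)" for \<theta> R
  have ray: "ray (Arg (z - p)) R" if "R \<in> \<R>" "z \<in> R" for z R
    unfolding ray_def
  proof safe
    fix r :: real assume r: "r > 0"
    have "z \<noteq> p" using that p by auto
    then have "norm (z - p) > 0" "rcis r (Arg (z - p)) = of_real (r / norm (z - p)) * (z - p)"
      by (simp_all add: rcis_def cis_Arg sgn_eq)
    then show "p + rcis r (Arg (z - p)) \<in> R"
      using cone[OF that, of "r / norm (z - p)"] r \<open>norm (z - p) > 0\<close> by simp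
  qed
  \<comment> \<open>The window starts at the direction of \<open>z0\<close>, and an argument below
    \<open>t0\<close> is raised by \<open>2 * pi\<close>. Forcing the angle \<open>t0\<close> on the
    region of \<open>z0\<close> makes it minimal, so this region heads the sorted list.\<close>
  have "\<exists>\<theta>. t0 \<le> \<theta> \<and> \<theta> < t0 + 2 * pi \<and> ray \<theta> R \<and> (z0 \<in> R \<longrightarrow> \<theta> = t0)" if R: "R \<in> \<R>" for R
  proof (cases "z0 \<in> R")
    case True
    then show ?thesis
      using ray[OF R True] by (intro exI[of _ t0]) (simp add: t0_def)
  next
    case False
    obtain z where z: "z \<in> R" using ne[OF R] by blast
    have bounds: "- pi < Arg (z - p)" "Arg (z - p) \<le> pi" "- pi < t0" "t0 \<le> pi"
      using Arg_bounded by (auto simp: t0_def)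
    have "ray (Arg (z - p) + 2 * pi) R"
      using ray[OF R z] by (simp add: ray_def rcis_def cis.ctr)
    then show ?thesis
      using False bounds ray[OF R z]
      by (cases "t0 \<le> Arg (z - p)") (auto intro: exI[of _ "Arg (z - p)"] exI[of _ "Arg (z - p) + 2 * pi"])
  qed
  then obtain f where f: "\<And>R. R \<in> \<R> \<Longrightarrow> t0 \<le> f R" "\<And>R. R \<in> \<R> \<Longrightarrow> f R < t0 + 2 * pi"
    "\<And>R. R \<in> \<R> \<Longrightarrow> ray (f R) R" "\<And>R. R \<in> \<R> \<Longrightarrow> z0 \<in> R \<Longrightarrow> f R = t0"
    by metis
  \<comment> \<open>Regions with equal angles would share a ray, contradicting disjointness.\<close>
  have inj: "inj_on f \<R>"
  proof
    fix R R' assume *: "R \<in> \<R>" "R' \<in> \<R>" "f R = f R'"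
    then have "p + rcis 1 (f R) \<in> R" "p + rcis 1 (f R) \<in> R'"
      using f(3)[OF *(1), unfolded ray_def, rule_format, of 1]
        f(3)[OF *(2), unfolded ray_def, rule_format, of 1] by simp_all
    then show "R = R'" using disj * by blast
  qed
  define xs where "xs = sorted_list_of_set (f ` \<R>)"
  define Rs where "Rs = map (the_inv_into \<R> f) xs"
  have set_xs: "set xs = f ` \<R>" and srt: "sorted_wrt (<) xs"
    using fin by (simp_all add: xs_def)
  have len: "length Rs = length xs" by (simp add: Rs_def)
  have nth: "Rs ! i \<in> \<R>" "f (Rs ! i) = xs ! i" if "i < length xs" for i
  proof -
    have "xs ! i \<in> f ` \<R>"
      using nth_mem[OF that] set_xs by simp
    then obtain R where "R \<in> \<R>" "xs ! i = f R" by blast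
    then show "Rs ! i \<in> \<R>" "f (Rs ! i) = xs ! i"
      using that inj by (simp_all add: Rs_def the_inv_into_f_f)
  qed
  have lt: "xs ! i < xs ! j" if "i < j" "j < length xs" for i j
    using sorted_wrt_nth_less[OF srt that] .
  have bounds: "t0 \<le> xs ! i" "xs ! i < t0 + 2 * pi" if "i < length xs" for i
    using f(1,2)[OF nth(1)[OF that]] nth(2)[OF that] by simp_all
  obtain R where R: "R \<in> \<R>" "z0 \<in> R" using z0 by blast
  have "t0 \<in> set xs"
    unfolding set_xs using f(4)[OF R] R(1) by blast
  then obtain k where k: "k < length xs" "xs ! k = t0" unfolding in_set_conv_nth by blast
  then have pos: "0 < length xs" by linarith
  have x0: "xs ! 0 = t0"
    using lt[of 0 k] bounds(1)[OF pos] k by (cases "k = 0") auto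
  have "ccw_angles (length Rs) ((!) xs)"
    unfolding ccw_angles_def len x0 using lt bounds(2) by (simp add: strict_mono_on_def)
  moreover have "\<forall>i<length Rs. \<forall>r>0. p + rcis r (xs ! i) \<in> Rs ! i"
    using f(3)[OF nth(1)] nth(2) by (simp add: ray_def len)
  moreover have "distinct Rs"
    unfolding Rs_def distinct_map set_xs
    using srt inj_on_the_inv_into[OF inj] by (simp add: strict_sorted_iff)
  moreover have "set Rs = \<R>"
    by (simp add: Rs_def set_xs image_image the_inv_into_f_f[OF inj])
  ultimately have num: "ccw_numbering p \<R> Rs"
    unfolding ccw_numbering_def by blast
  have "f (Rs ! 0) = f R"
    using nth(2)[OF pos] x0 f(4)[OF R] by simp
  then have "Rs ! 0 = R"
    using inj_onD[OF inj _ nth(1)[OF pos] R(1)] by blast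
  with num R show ?thesis by blast
qed

section \<open>The six regions of a triangle\<close>

locale triangle =
  fixes A B C :: complex
  assumes non_collinear: "\<not> collinear {A, B, C}"
begin

abbreviation p :: complex where "p \<equiv> circumcenter A B C"

definition bisectors :: "complex set set" where
  "bisectors = {perp_bisector A B, perp_bisector B C, perp_bisector C A}"

text \<open>No point is nearer to \<open>B\<close> than to \<open>A\<close>, nearer to \<open>C\<close> than to \<open>B\<close> and nearer to \<open>A\<close> than to \<open>C\<close>,
  nor the reverse; the remaining six comparison patterns label the regions.\<close>

definition nearer :: "complex \<Rightarrow> bool \<times> bool \<times> bool" where
  "nearer z = (dist z B < dist z A, dist z C < dist z B, dist z A < dist z C)"

text \<open>The comparisons in \<open>nearer\<close> are strict, so a tie would read as
  \<open>False\<close>. Off the bisectors, \<open>False\<close> means the strict reverse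
  inequality.\<close>

definition sector :: "bool \<times> bool \<times> bool \<Rightarrow> complex set" where
  "sector s = {z. z \<notin> \<Union>bisectors \<and> nearer z = s}"

lemma equidistant: "dist p A = dist p B" "dist p B = dist p C" "dist p C = dist p A"
  using circumcenter_equidistant(1,2)[OF non_collinear] by simp_all

lemma bisectors_eq: "bisectors = hyperplanes_through p {B - A, C - B, A - C}"
  unfolding bisectors_def hyperplanes_through_def
  by (simp add: perp_bisector_through[OF equidistant(1)] perp_bisector_through[OF equidistant(2)]
      perp_bisector_through[OF equidistant(3)])

lemma nearer_iff:
  "nearer z = (0 < (z - p) \<bullet> (B - A), 0 < (z - p) \<bullet> (C - B), 0 < (z - p) \<bullet> (A - C))"
  by (simp add: nearer_def inner_pos_iff_closer[OF equidistant(1)] inner_pos_iff_closer[OF equidistant(2)]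
      inner_pos_iff_closer[OF equidistant(3)])

lemma off_bisectors_iff:
  "z \<notin> \<Union>bisectors \<longleftrightarrow>
     (z - p) \<bullet> (B - A) \<noteq> 0 \<and> (z - p) \<bullet> (C - B) \<noteq> 0 \<and> (z - p) \<bullet> (A - C) \<noteq> 0"
  unfolding bisectors_eq off_hyperplanes_iff by simp

lemma component_eq_sector:
  assumes "z \<notin> \<Union>bisectors"
  shows "connected_component_set (- \<Union>bisectors) z = sector (nearer z)"
  unfolding connected_component_off_hyperplanes[OF assms[unfolded bisectors_eq], folded bisectors_eq]
    sector_def nearer_iff by (simp del: Union_iff)

text \<open>Constant triples are cyclic chains of strict inequalities. Every other triple occurs
  because the inner products with the three normals can be prescribed freely, provided that they sum
  to zero.\<close>

lemma nearer_off_bisectors: "nearer ` (- \<Union>bisectors) = mixed_signs"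
proof
  show "nearer ` (- \<Union>bisectors) \<subseteq> mixed_signs"
  proof (rule image_subsetI)
    fix z assume "z \<in> - \<Union>bisectors"
    then have "dist z A \<noteq> dist z B" "dist z B \<noteq> dist z C" "dist z C \<noteq> dist z A"
      by (simp_all add: bisectors_def mem_perp_bisector_iff)
    then show "nearer z \<in> mixed_signs"
      by (auto simp: mixed_signs_def nearer_def)
  qed
  show "mixed_signs \<subseteq> nearer ` (- \<Union>bisectors)"
  proof clarify
    fix a b c assume s: "(a, b, c) \<in> mixed_signs"
    \<comment> \<open>The sign that differs from the other two gets absolute value 2 and the others
      get 1, so the three values sum to zero and the third, \<open>- x - y\<close>, has the sign
      required by \<open>c\<close>.\<close>
    define x y :: real where "x = (if a then if b = c then 2 else 1 else if b = c then -2 else -1)"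
      and "y = (if b then if a = c then 2 else 1 else if a = c then -2 else -1)"
    obtain d where d: "d \<bullet> (B - A) = x" "d \<bullet> (C - B) = y"
      by (rule inner_system_solvable[OF not_collinear_cross[OF non_collinear]])
    then have e: "d \<bullet> (A - C) = - x - y"
      by (simp add: inner_diff_right)
    have "nearer (p + d) = (a, b, c)"
      unfolding nearer_iff add_diff_cancel_left' d e using s
      by (cases a; cases b; cases c; simp add: x_def y_def mixed_signs_def)
    moreover have "p + d \<notin> \<Union>bisectors"
      unfolding off_bisectors_iff add_diff_cancel_left' d e using s
      by (cases a; cases b; cases c; simp add: x_def y_def mixed_signs_def)
    ultimately show "(a, b, c) \<in> nearer ` (- \<Union>bisectors)"
      by (metis ComplI image_eqI)
  qed
qed

lemma regions_eq: "regions bisectors = sector ` mixed_signs"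
  unfolding regions_def components_def nearer_off_bisectors[symmetric] image_image
  by (rule image_cong[OF refl], rule component_eq_sector, rule ComplD)

lemma sector_nonempty:
  assumes "s \<in> mixed_signs"
  obtains z where "z \<in> sector s"
  using assms unfolding nearer_off_bisectors[symmetric] sector_def by blast

lemma inj_sector: "inj_on sector mixed_signs"
proof (rule inj_onI)
  fix s t assume "s \<in> mixed_signs" "sector s = sector t"
  then obtain z where "z \<in> sector s" "z \<in> sector t"
    using sector_nonempty by metis
  then show "s = t" by (simp add: sector_def)
qed

lemma card_regions: "card (regions bisectors) = 6"
proof -
  have "card mixed_signs = CARD(bool \<times> bool \<times> bool) - card {(True, True, True), (False, False, False)}"
    unfolding mixed_signs_def Compl_eq_Diff_UNIV by (simp add: card_Diff_subset)
  then have "card mixed_signs = 6" by simp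
  then show ?thesis
    by (simp add: regions_eq card_image inj_sector)
qed

text \<open>Scaling about \<open>p\<close> by a positive factor preserves the signs of all inner
  products, so the sectors are cones. The starting point is left free: a vertex serves for the
  triangle, the point 1 for occupancy words.\<close>

lemma numbering_exists:
  assumes "z \<notin> \<Union>bisectors"
  shows "\<exists>Rs. ccw_numbering p (regions bisectors) Rs \<and> z \<in> Rs ! 0"
proof (rule ccw_numbering_exists)
  show "finite (regions bisectors)"
    using card_regions card.infinite by fastforce
  show "R \<noteq> {}" if "R \<in> regions bisectors" for R
    using that sector_nonempty unfolding regions_eq by blast
  show "R = R'" if "R \<in> regions bisectors" "R' \<in> regions bisectors" "w \<in> R" "w \<in> R'" for R R' w
    using that unfolding regions_eq sector_def by blast
  show "p + of_real r * (w - p) \<in> R" if "R \<in> regions bisectors" "w \<in> R" "r > 0" for R w r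
  proof -
    have "(p + of_real r * (w - p) - p) \<bullet> n = r * ((w - p) \<bullet> n)" for n
      by (simp add: inner_complex_def algebra_simps)
    then have "p + of_real r * (w - p) \<in> sector s \<longleftrightarrow> w \<in> sector s" for s
      unfolding sector_def mem_Collect_eq nearer_iff off_bisectors_iff
      using \<open>r > 0\<close> by (simp add: zero_less_mult_iff)
    then show ?thesis
      using that unfolding regions_eq by blast
  qed
  show "p \<notin> \<Union>(regions bisectors)"
    unfolding regions_eq sector_def Union_iff using off_bisectors_iff[of p] by simp
  have "z \<in> sector (nearer z)"
    using assms unfolding sector_def by blast
  moreover have "nearer z \<in> mixed_signs"
    unfolding nearer_off_bisectors[symmetric] using assms by blast
  ultimately show "z \<in> \<Union>(regions bisectors)"
    unfolding regions_eq by blast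
qed

end

section \<open>Positions of the vertices in a numbering\<close>

lemma nonalternating_inner_cis:
  assumes "ccw_angles 6 \<theta>" and nz: "\<And>i. i < 6 \<Longrightarrow> cis (\<theta> i) \<bullet> n \<noteq> 0"
  shows "nonalternating (\<lambda>i. 0 < cis (\<theta> i) \<bullet> n)"
  unfolding nonalternating_def
proof (intro allI impI notI)
  fix i j k l :: nat
  assume ord: "i < j" "j < k" "k < l" "l < 6"
    and alt: "(0 < cis (\<theta> i) \<bullet> n) \<noteq> (0 < cis (\<theta> j) \<bullet> n) \<and>
      (0 < cis (\<theta> j) \<bullet> n) \<noteq> (0 < cis (\<theta> k) \<bullet> n) \<and> (0 < cis (\<theta> k) \<bullet> n) \<noteq> (0 < cis (\<theta> l) \<bullet> n)"
  have mono: "\<theta> a < \<theta> b" if "a < b" "b < 6" for a b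
    using assms(1) that by (simp add: ccw_angles_def strict_mono_on_def)
  have "\<theta> 0 \<le> \<theta> i"
    using mono[of 0 i] ord by (cases "i = 0") auto
  moreover have "\<theta> l < \<theta> 0 + 2 * pi"
    using assms(1) ord by (simp add: ccw_angles_def)
  ultimately have t: "\<theta> i < \<theta> j" "\<theta> j < \<theta> k" "\<theta> k < \<theta> l" "\<theta> l < \<theta> i + 2 * pi"
    using mono[of i j] mono[of j k] mono[of k l] ord by linarith+
  have "cis (\<theta> i) \<bullet> n \<noteq> 0" "cis (\<theta> j) \<bullet> n \<noteq> 0" "cis (\<theta> k) \<bullet> n \<noteq> 0" "cis (\<theta> l) \<bullet> n \<noteq> 0"
    using nz ord by simp_all
  then show False
    using alt no_inner_cis_alternation[OF t, of n] no_inner_cis_alternation'[OF t, of n] by linarith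
qed

locale scalene_triangle = triangle +
  assumes AB_less_BC: "dist A B < dist B C" and BC_less_CA: "dist B C < dist C A"
begin

text \<open>At a vertex two of the three comparisons involve the distance zero to itself and are
  settled by distinctness; the third compares the two sides meeting there, and only this one uses
  the order of the lengths.\<close>

lemma vertex_sectors:
  "A \<in> sector (False, False, True)" "B \<in> sector (True, False, True)" "C \<in> sector (True, True, False)"
proof -
  have "A \<noteq> B"
    using non_collinear by (auto simp: insert_commute)
  moreover from this have "B \<noteq> C" "A \<noteq> C"
    using AB_less_BC BC_less_CA by auto
  ultimately show "A \<in> sector (False, False, True)" "B \<in> sector (True, False, True)"
    "C \<in> sector (True, True, False)"
    using AB_less_BC BC_less_CA dist_commute[of A B] dist_commute[of B C] dist_commute[of C A]
    by (auto simp: sector_def bisectors_def nearer_def mem_perp_bisector_iff)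
qed

context
  fixes Rs
  assumes num: "ccw_numbering p (regions bisectors) Rs"
begin

lemma numbering_simps: "set Rs = sector ` mixed_signs" "distinct Rs"
  using num unfolding ccw_numbering_def regions_eq by - (elim conjE, assumption)+

lemma length_numbering: "length Rs = 6"
  using distinct_card[OF numbering_simps(2)] card_regions unfolding numbering_simps(1) regions_eq
  by (rule trans[OF sym])

lemma numbering_sector:
  assumes "i < 6"
  obtains s where "s \<in> mixed_signs" "Rs ! i = sector s"
proof -
  have "Rs ! i \<in> sector ` mixed_signs"
    using nth_mem[of i Rs] assms unfolding length_numbering numbering_simps by blast
  then show thesis by (elim imageE) (rule that)
qed

lemma numbering_inj:
  assumes "i < 6" "j < 6" "Rs ! i = Rs ! j"
  shows "i = j"
  using nth_eq_iff_index_eq[OF numbering_simps(2), of i j] assms unfolding length_numbering by blast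

lemma numbering_disjoint:
  assumes "i < 6" "j < 6" "z \<in> Rs ! i" "z \<in> Rs ! j"
  shows "i = j"
proof -
  obtain s where s: "Rs ! i = sector s"
    using assms(1) by (rule numbering_sector)
  obtain t where t: "Rs ! j = sector t"
    using assms(2) by (rule numbering_sector)
  have "s = nearer z" "t = nearer z"
    using assms(3,4) unfolding s t sector_def mem_Collect_eq by - (elim conjE, rule sym, assumption)+
  then have "Rs ! i = Rs ! j" by (simp only: s t)
  then show ?thesis
    using assms(1,2) numbering_inj by blast
qed

text \<open>Sampling the ray of each region at distance 1 from \<open>p\<close> turns the list into
  three sign sequences, to which \<open>sign_triples_arrangement\<close> applies, starting from the
  triple of \<open>A\<close>.\<close>

lemma vertex_positions:
  obtains a where "a < 6" "A \<in> Rs ! a" "C \<in> Rs ! ((a + 3) mod 6)"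
    "B \<in> Rs ! ((a + 1) mod 6) \<or> B \<in> Rs ! ((a + 5) mod 6)"
proof -
  have "\<exists>\<theta>. ccw_angles 6 \<theta> \<and> (\<forall>i<6. \<forall>r>0. p + rcis r (\<theta> i) \<in> Rs ! i)"
    using num unfolding ccw_numbering_def length_numbering by (elim conjE)
  then obtain \<theta> where \<theta>: "ccw_angles 6 \<theta>" "\<forall>i<6. \<forall>r>0. p + rcis r (\<theta> i) \<in> Rs ! i"
    by (elim exE conjE) (rule that)
  define u v w where "u i = (0 < cis (\<theta> i) \<bullet> (B - A))" and "v i = (0 < cis (\<theta> i) \<bullet> (C - B))"
    and "w i = (0 < cis (\<theta> i) \<bullet> (A - C))" for i
  have signs: "Rs ! i = sector (u i, v i, w i)" "(u i, v i, w i) \<in> mixed_signs"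
    and nz: "cis (\<theta> i) \<bullet> (B - A) \<noteq> 0" "cis (\<theta> i) \<bullet> (C - B) \<noteq> 0" "cis (\<theta> i) \<bullet> (A - C) \<noteq> 0"
    if i: "i < 6" for i
  proof -
    obtain s where s: "s \<in> mixed_signs" "Rs ! i = sector s"
      using i by (rule numbering_sector)
    have "p + rcis 1 (\<theta> i) \<in> sector s"
      using \<theta>(2)[rule_format, OF i, of 1] by (simp only: s zero_less_one)
    then have *: "p + cis (\<theta> i) \<notin> \<Union>bisectors" "nearer (p + cis (\<theta> i)) = s"
      unfolding sector_def by (simp_all add: rcis_def del: Union_iff)
    show "cis (\<theta> i) \<bullet> (B - A) \<noteq> 0" "cis (\<theta> i) \<bullet> (C - B) \<noteq> 0" "cis (\<theta> i) \<bullet> (A - C) \<noteq> 0"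
      using *(1) unfolding off_bisectors_iff by simp_all
    have "s = (u i, v i, w i)"
      using *(2) unfolding nearer_iff u_def v_def w_def by simp
    with s show "Rs ! i = sector (u i, v i, w i)" "(u i, v i, w i) \<in> mixed_signs" by simp_all
  qed
  have alt: "nonalternating u" "nonalternating v" "nonalternating w"
    unfolding u_def[abs_def] v_def[abs_def] w_def[abs_def]
    by (rule nonalternating_inner_cis[OF \<theta>(1) nz(1)] nonalternating_inner_cis[OF \<theta>(1) nz(2)]
        nonalternating_inner_cis[OF \<theta>(1) nz(3)]; assumption)+
  have cst: "\<forall>i<6. u i \<noteq> v i \<or> v i \<noteq> w i"
    using signs(2) by (auto simp: mixed_signs_def)
  have inj: "i = j" if "i < 6" "j < 6" "u i = u j" "v i = v j" "w i = w j" for i j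
  proof -
    have "Rs ! i = Rs ! j"
      unfolding signs(1)[OF that(1)] signs(1)[OF that(2)] that(3-5) by (rule refl)
    then show ?thesis by (rule numbering_inj[OF that(1,2)])
  qed
  have "sector (False, False, True) \<in> set Rs"
    unfolding numbering_simps by (simp add: mixed_signs_def)
  then obtain a where a: "a < 6" "Rs ! a = sector (False, False, True)"
    unfolding in_set_conv_nth length_numbering by blast
  have "A \<in> sector (u a, v a, w a)"
    using vertex_sectors(1) unfolding signs(1)[OF a(1), symmetric] a(2) .
  then have "\<not> u a" "\<not> v a" "w a"
    using vertex_sectors(1) unfolding sector_def by simp_all
  note c = sign_triples_arrangement[OF alt cst inj a(1) this]
  have mem: "z \<in> Rs ! (i mod 6)" if "z \<in> sector (x, y, t)" "u (i mod 6) = x" "v (i mod 6) = y" "w (i mod 6) = t"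
    for z x y t i
  proof -
    have "i mod 6 < 6" by simp
    from signs(1)[OF this] that show ?thesis by (simp only:)
  qed
  show thesis
  proof (rule that[OF a(1)])
    show "A \<in> Rs ! a" unfolding a(2) by (rule vertex_sectors)
    show "C \<in> Rs ! ((a + 3) mod 6)"
      by (rule mem[OF vertex_sectors(3)]) (simp_all only: c(1-3))
    show "B \<in> Rs ! ((a + 1) mod 6) \<or> B \<in> Rs ! ((a + 5) mod 6)"
      using c(4) mem[OF vertex_sectors(2)] by blast
  qed
qed

text \<open>Counting regions from that of \<open>A\<close>, the region of \<open>C\<close> is opposite; \<open>b\<close> is 1 or 5 according to
  the orientation of the triangle.\<close>

lemma vertex_pattern:
  "\<exists>a b. (b = 1 \<or> b = 5) \<and> (\<forall>k<6. Rs ! ((a + k) mod 6) \<inter> {A, B, C} =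
     (if k = 0 then {A} else if k = b then {B} else if k = 3 then {C} else {}))"
proof -
  obtain a where a: "a < 6" "A \<in> Rs ! a" and c: "C \<in> Rs ! ((a + 3) mod 6)"
    and "B \<in> Rs ! ((a + 1) mod 6) \<or> B \<in> Rs ! ((a + 5) mod 6)"
    by (rule vertex_positions)
  then obtain b :: nat where b: "b = 1 \<or> b = 5" "B \<in> Rs ! ((a + b) mod 6)" by blast
  have iff: "X \<in> Rs ! ((a + k) mod 6) \<longleftrightarrow> k = m" if "X \<in> Rs ! ((a + m) mod 6)" "k < 6" "m < 6" for X k m
  proof
    assume "X \<in> Rs ! ((a + k) mod 6)"
    then have "(a + k) mod 6 = (a + m) mod 6"
      by (rule numbering_disjoint[rotated 2]) (use that in simp_all)
    then show "k = m" using that(2,3) by (rule add_mod_left_cancel)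
  qed (use that in simp)
  have mem: "A \<in> Rs ! ((a + k) mod 6) \<longleftrightarrow> k = 0" "B \<in> Rs ! ((a + k) mod 6) \<longleftrightarrow> k = b"
    "C \<in> Rs ! ((a + k) mod 6) \<longleftrightarrow> k = 3" if "k < 6" for k
    using iff[of A 0 k] iff[of B b k] iff[of C 3 k] a b c that by auto
  have "Rs ! ((a + k) mod 6) \<inter> {A, B, C} =
       (if k = 0 then {A} else if k = b then {B} else if k = 3 then {C} else {})" if "k < 6" for k
    using b(1) mem[OF that] by auto
  with b(1) show ?thesis by blast
qed

text \<open>Offsets are counted from a base \<open>a\<close> and may reach 6, a full turn, so that a
  gap ending at the base needs no wraparound. Both orders follow since
  \<open>separated_by_empty\<close> is symmetric in the two points.\<close>

lemma separated_by_emptyI: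
  assumes "x \<in> Rs ! ((a + m) mod 6)" "y \<in> Rs ! ((a + n) mod 6)" "n = m + k + 1"
    and "\<And>s. m < s \<Longrightarrow> s < n \<Longrightarrow> Rs ! ((a + s) mod 6) \<inter> S = {}"
  shows "separated_by_empty k S Rs x y \<and> separated_by_empty k S Rs y x"
proof -
  define i j where "i = (a + m) mod 6" and "j = (a + n) mod 6"
  have shift: "(i + t) mod 6 = (a + (m + t)) mod 6" for t
    unfolding i_def by (simp only: mod_add_left_eq add.assoc)
  have "i < 6" "j < 6" by (simp_all add: i_def j_def)
  moreover have "j = (i + k + 1) mod 6"
    using shift[of "k + 1"] by (simp only: j_def assms(3) add.assoc)
  moreover have "x \<in> Rs ! i" "y \<in> Rs ! j"
    using assms(1,2) by (simp_all only: i_def j_def)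
  moreover have "\<forall>t\<in>{1..k}. Rs ! ((i + t) mod 6) \<inter> S = {}"
    unfolding shift using assms(4) by (simp add: assms(3))
  ultimately show ?thesis
    unfolding separated_by_empty_def length_numbering by blast
qed

lemma vertices_separated:
  "separated_by_empty 0 {A, B, C} Rs A B"
  "separated_by_empty 1 {A, B, C} Rs B C"
  "separated_by_empty 2 {A, B, C} Rs C A"
proof -
  obtain a b where b: "b = 1 \<or> b = 5" and pat: "\<forall>k<6. Rs ! ((a + k) mod 6) \<inter> {A, B, C} =
       (if k = 0 then {A} else if k = b then {B} else if k = 3 then {C} else {})"
    using vertex_pattern by (elim exE conjE) (rule that)
  \<comment> \<open>Offsets 0 and 6 are the same position; \<open>A\<close> is recorded under both
    to close gaps at either end.\<close>
  have pos: "A \<in> Rs ! ((a + 0) mod 6)" "A \<in> Rs ! ((a + 6) mod 6)"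
      "B \<in> Rs ! ((a + b) mod 6)" "C \<in> Rs ! ((a + 3) mod 6)"
    using pat[rule_format, of 0] pat[rule_format, of b] pat[rule_format, of 3] b by auto
  have empty: "Rs ! ((a + k) mod 6) \<inter> {A, B, C} = {}" if "k < 6" "k \<noteq> 0" "k \<noteq> b" "k \<noteq> 3" for k
    using pat that by simp
  from b have "separated_by_empty 0 {A, B, C} Rs A B \<and> separated_by_empty 1 {A, B, C} Rs B C \<and>
    separated_by_empty 2 {A, B, C} Rs C A"
  proof
    assume [simp]: "b = 1"
    have "separated_by_empty 0 {A, B, C} Rs A B"
      by (rule separated_by_emptyI[THEN conjunct1, of A a 0 B 1], use pos in simp, use pos in simp, simp,
          rule empty) simp_all
    moreover have "separated_by_empty 1 {A, B, C} Rs B C"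
      by (rule separated_by_emptyI[THEN conjunct1, of B a 1 C 3], use pos in simp, use pos in simp, simp,
          rule empty) simp_all
    moreover have "separated_by_empty 2 {A, B, C} Rs C A"
      by (rule separated_by_emptyI[THEN conjunct1, of C a 3 A 6], use pos in simp, use pos in simp, simp,
          rule empty) simp_all
    ultimately show ?thesis by blast
  next
    \<comment> \<open>The mirror image: from \<open>A\<close> come two empty regions,
      \<open>C\<close>, one empty region and \<open>B\<close>. The gaps are the same but run from
      the second point to the first, hence \<open>conjunct2\<close>.\<close>
    assume [simp]: "b = 5"
    have "separated_by_empty 0 {A, B, C} Rs A B"
      by (rule separated_by_emptyI[THEN conjunct2, of B a 5 A 6], use pos in simp, use pos in simp, simp,
          rule empty) simp_all
    moreover have "separated_by_empty 1 {A, B, C} Rs B C"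
      by (rule separated_by_emptyI[THEN conjunct2, of C a 3 B 5], use pos in simp, use pos in simp, simp,
          rule empty) simp_all
    moreover have "separated_by_empty 2 {A, B, C} Rs C A"
      by (rule separated_by_emptyI[THEN conjunct2, of A a 0 C 3], use pos in simp, use pos in simp, simp,
          rule empty) simp_all
    ultimately show ?thesis by blast
  qed
  then show "separated_by_empty 0 {A, B, C} Rs A B"
    "separated_by_empty 1 {A, B, C} Rs B C"
    "separated_by_empty 2 {A, B, C} Rs C A"
    by blast+
qed

lemma occupancy_rotate:
  "\<exists>a. rotate a (map (\<lambda>R. card (R \<inter> {A, B, C})) Rs) \<in> {[1, 1, 0, 1, 0, 0], [1, 0, 0, 1, 0, 1]}"
proof -
  let ?w = "map (\<lambda>R. card (R \<inter> {A, B, C})) Rs"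
  obtain a b where b: "b = 1 \<or> b = 5" and pat: "\<forall>k<6. Rs ! ((a + k) mod 6) \<inter> {A, B, C} =
       (if k = 0 then {A} else if k = b then {B} else if k = 3 then {C} else {})"
    using vertex_pattern by (elim exE conjE) (rule that)
  have "rotate a ?w = map (\<lambda>k. if k = 0 \<or> k = b \<or> k = 3 then 1 else 0) [0..<6]"
    by (rule nth_equalityI) (simp_all add: length_numbering nth_rotate pat)
  also have "\<dots> \<in> {[1, 1, 0, 1, 0, 0], [1, 0, 0, 1, 0, 1]}"
    using b by (auto simp: upt_rec)
  finally show ?thesis by blast
qed

end
end

section \<open>Triangles on the unit circle and bracelets\<close>

text \<open>Along the line \<open>a + t *\<^sub>R d\<close> with \<open>d = b - a\<close>, having
  norm 1 is a quadratic condition on \<open>t\<close> with roots 0 and 1, so a third point of the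
  line on the circle would be \<open>a\<close> or \<open>b\<close>.\<close>

lemma unit_circle_not_collinear:
  fixes a b c :: complex
  assumes "norm a = 1" "norm b = 1" "norm c = 1" "a \<noteq> b" "b \<noteq> c" "c \<noteq> a"
  shows "\<not> collinear {a, b, c}"
proof
  assume "collinear {a, b, c}"
  then have "collinear {b, a, c}"
    by (simp add: insert_commute)
  then have "collinear {0, b - a, c - a}"
    by (simp add: collinear_3)
  moreover have "b - a \<noteq> 0" "c - a \<noteq> 0"
    using assms by simp_all
  ultimately obtain t where t: "c - a = t *\<^sub>R (b - a)"
    unfolding collinear_lemma by blast
  define d where "d = b - a"
  have d: "b = a + d" "c = a + t *\<^sub>R d" "d \<noteq> 0"
    using t \<open>b - a \<noteq> 0\<close> unfolding d_def[symmetric] by (simp_all add: d_def diff_eq_eq)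
  have "a \<bullet> a = 1" "(a + d) \<bullet> (a + d) = 1" "(a + t *\<^sub>R d) \<bullet> (a + t *\<^sub>R d) = 1"
    using assms(1-3) unfolding d(1,2) norm_eq_1 by simp_all
  then have "2 * (a \<bullet> d) = - (d \<bullet> d)" "t * (2 * (a \<bullet> d)) + t * t * (d \<bullet> d) = 0"
    by (simp_all add: inner_add_left inner_add_right inner_commute[of d a] algebra_simps)
  then have "t * (t - 1) * (d \<bullet> d) = 0"
    by (simp add: algebra_simps)
  then have "t = 0 \<or> t = 1" using d(3) by simp
  then show False using d(1,2) assms(5,6) by (elim disjE) simp_all
qed

lemma bracelet_equiv_rotate: "bracelet_equiv w (rotate k w)"
proof (induction k)
  case 0
  then show ?case by (simp add: bracelet_equiv_def)
next
  case (Suc k)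
  have "bracelet_equiv (rotate k w) (rotate (Suc k) w)"
    unfolding bracelet_equiv_def by (rule r_into_equivclp) simp
  with Suc show ?case
    unfolding bracelet_equiv_def by (rule equivclp_trans)
qed

lemma bracelet_equiv_rev: "bracelet_equiv w (rev w)"
  unfolding bracelet_equiv_def by (rule r_into_equivclp) simp

lemma bracelet_eqI:
  assumes "bracelet_equiv v w"
  shows "bracelet v = bracelet w"
  using assms unfolding bracelet_def bracelet_equiv_def
  by (blast intro: equivclp_trans equivclp_sym)

lemma bracelet_rotate: "bracelet (rotate k w) = bracelet w"
  by (rule bracelet_eqI[OF bracelet_equiv_rotate, symmetric])

lemma bracelet_rev: "bracelet (rev w) = bracelet w"
  by (rule bracelet_eqI[OF bracelet_equiv_rev, symmetric])

text \<open>Sorting the sides permutes the vertices and the bisectors. The sorted labelling may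
  reverse the orientation, which is harmless because \<open>scalene_triangle\<close> fixes
  none.\<close>

lemma scalene_relabel:
  fixes x y z :: complex
  assumes "dist x y \<noteq> dist y z" "dist y z \<noteq> dist z x" "dist z x \<noteq> dist x y"
  obtains A B C where "dist A B < dist B C" "dist B C < dist C A" "{A, B, C} = {x, y, z}"
    "{perp_bisector A B, perp_bisector B C, perp_bisector C A} =
     {perp_bisector x y, perp_bisector y z, perp_bisector z x}"
proof -
  consider "dist x y < dist y z" "dist y z < dist z x" | "dist x y < dist z x" "dist z x < dist y z"
    | "dist y z < dist x y" "dist x y < dist z x" | "dist y z < dist z x" "dist z x < dist x y"
    | "dist z x < dist x y" "dist x y < dist y z" | "dist z x < dist y z" "dist y z < dist x y"
    using assms by linarith
  then show thesis
  proof cases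
    case 1
    then show thesis by (rule that) (rule refl)+
  next
    case 2
    show thesis
      by (rule that[of y x z]; use 2 in \<open>simp add: dist_commute perp_bisector_commute insert_commute\<close>)
  next
    case 3
    show thesis
      by (rule that[of z y x]; use 3 in \<open>simp add: dist_commute perp_bisector_commute insert_commute\<close>)
  next
    case 4
    show thesis
      by (rule that[of y z x]; use 4 in \<open>simp add: dist_commute perp_bisector_commute insert_commute\<close>)
  next
    case 5
    show thesis
      by (rule that[of z x y]; use 5 in \<open>simp add: dist_commute perp_bisector_commute insert_commute\<close>)
  next
    case 6
    show thesis
      by (rule that[of x z y]; use 6 in \<open>simp add: dist_commute perp_bisector_commute insert_commute\<close>)
  qed
qed

lemma generic_triangle:
  assumes "ccw_on_unit_circle 3 P" "generic 3 P"
  obtains A B C where "scalene_triangle A B C" "circumcenter A B C = 0"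
    "triangle.bisectors A B C = bisector 3 P ` {..<3}" "{A, B, C} = P ` {..<3}" "inj_on P {..<3}"
proof -
  have three: "{..<3} = {0, 1, 2 :: nat}" by auto
  have unit: "norm (P i) = 1" if "i < 3" for i
    using assms(1) that by (auto simp: ccw_on_unit_circle_def)
  have mods: "Suc 0 mod 3 = 1" "Suc 1 mod 3 = 2" "Suc 2 mod 3 = 0"
    by simp_all
  have b: "bisector 3 P 0 = perp_bisector (P 0) (P 1)" "bisector 3 P 1 = perp_bisector (P 1) (P 2)"
    "bisector 3 P 2 = perp_bisector (P 2) (P 0)"
    unfolding bisector_def mods by (rule refl)+
  have "P j \<notin> bisector 3 P i" if "i < 3" "j < 3" for i j
    using assms(2) that by (simp add: generic_def)
  \<comment> \<open>Instances at an endpoint of the side give distinct points; those at the opposite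
    vertex give unequal lengths of the two other sides.\<close>
  from this[of 0 0] this[of 0 2] this[of 1 0] this[of 1 1] this[of 2 1] this[of 2 2]
  have ne: "dist (P 0) (P 0) \<noteq> dist (P 0) (P 1)" "dist (P 1) (P 1) \<noteq> dist (P 1) (P 2)"
      "dist (P 2) (P 2) \<noteq> dist (P 2) (P 0)"
    and d': "dist (P 2) (P 0) \<noteq> dist (P 2) (P 1)" "dist (P 0) (P 1) \<noteq> dist (P 0) (P 2)"
      "dist (P 1) (P 2) \<noteq> dist (P 1) (P 0)"
    unfolding b mem_perp_bisector_iff by simp_all
  have d: "dist (P 0) (P 1) \<noteq> dist (P 1) (P 2)" "dist (P 1) (P 2) \<noteq> dist (P 2) (P 0)"
    "dist (P 2) (P 0) \<noteq> dist (P 0) (P 1)"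
    using d' dist_commute[of "P 0" "P 1"] dist_commute[of "P 1" "P 2"] dist_commute[of "P 2" "P 0"]
    by linarith+
  have distinct: "P 0 \<noteq> P 1" "P 1 \<noteq> P 2" "P 2 \<noteq> P 0"
    using ne by (metis dist_self)+
  then have inj: "inj_on P {..<3}"
    unfolding three by simp
  have nc: "\<not> collinear {P 0, P 1, P 2}"
    by (rule unit_circle_not_collinear[OF unit unit unit distinct]) simp_all
  obtain A B C where ABC: "dist A B < dist B C" "dist B C < dist C A" "{A, B, C} = {P 0, P 1, P 2}"
    "{perp_bisector A B, perp_bisector B C, perp_bisector C A} =
     {perp_bisector (P 0) (P 1), perp_bisector (P 1) (P 2), perp_bisector (P 2) (P 0)}"
    by (rule scalene_relabel[OF d])
  have nc': "\<not> collinear {A, B, C}"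
    using nc ABC(3) by simp
  then interpret scalene_triangle A B C
    using nc' ABC(1,2) by (intro scalene_triangle.intro triangle.intro scalene_triangle_axioms.intro)
  have "norm z = 1" if "z \<in> {P 0, P 1, P 2}" for z
    using that unit by (elim insertE emptyE) simp_all
  then have "norm A = 1" "norm B = 1" "norm C = 1"
    unfolding ABC(3)[symmetric] by simp_all
  then have circ: "circumcenter A B C = 0"
    using circumcenter_equidistant(3)[OF nc', of 0] by simp
  have bis: "bisectors = bisector 3 P ` {..<3}"
    unfolding bisectors_def three image_insert image_empty b by (rule ABC(4))
  have set: "{A, B, C} = P ` {..<3}"
    unfolding three image_insert image_empty by (rule ABC(3))
  show thesis
    by (rule that[OF scalene_triangle_axioms circ bis set inj])
qed

section \<open>Realizable words for three points\<close>

lemma realizable_bracelet: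
  assumes "realizable 3 w"
  shows "bracelet w = bracelet [0, 1, 0, 0, 1, 1]"
proof -
  obtain P Rs where P: "ccw_on_unit_circle 3 P" "generic 3 P"
    and Rs: "ccw_numbering 0 (regions (bisector 3 P ` {..<3})) Rs"
    and w: "w = map (\<lambda>R. card {j. j < 3 \<and> P j \<in> R}) Rs"
    using assms unfolding realizable_def occupancy_word_def by blast
  obtain A B C where ABC: "scalene_triangle A B C" "circumcenter A B C = 0"
    "triangle.bisectors A B C = bisector 3 P ` {..<3}" "{A, B, C} = P ` {..<3}" "inj_on P {..<3}"
    by (rule generic_triangle[OF P])
  interpret scalene_triangle A B C by fact
  \<comment> \<open>Occupancy counts indices rather than points; the counts agree because
    \<open>P\<close> is injective.\<close>
  have "card {j. j < 3 \<and> P j \<in> R} = card (R \<inter> {A, B, C})" for R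
  proof -
    have "R \<inter> {A, B, C} = P ` {j. j < 3 \<and> P j \<in> R}"
      unfolding ABC(4) by auto
    moreover have "inj_on P {j. j < 3 \<and> P j \<in> R}"
      by (rule inj_on_subset[OF ABC(5)]) auto
    ultimately show ?thesis by (simp add: card_image)
  qed
  then have "w = map (\<lambda>R. card (R \<inter> {A, B, C})) Rs"
    by (simp add: w)
  moreover have "ccw_numbering p (regions bisectors) Rs"
    using Rs by (simp only: ABC)
  ultimately obtain a where "rotate a w \<in> {[1, 1, 0, 1, 0, 0], [1, 0, 0, 1, 0, 1]}"
    using occupancy_rotate by blast
  \<comment> \<open>One orientation gives a shift of the representative, the other a shift of its
    reversal.\<close>
  then have "rotate a w = rotate 4 [0, 1, 0, 0, 1, 1] \<or> rotate a w = rotate 1 (rev [0, 1, 0, 0, 1, 1])"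
    by (simp add: rotate_drop_take)
  then have "bracelet (rotate a w) = bracelet [0, 1, 0, 0, 1, 1]"
    by (elim disjE) (simp_all only: bracelet_rotate bracelet_rev)
  then show ?thesis by (simp only: bracelet_rotate)
qed

text \<open>The angles 0, \<open>pi / 2\<close> and \<open>2 * pi / 3\<close> cut arcs of
  \<open>pi / 2\<close>, \<open>pi / 6\<close> and \<open>4 * pi / 3\<close>, whose chords have
  different lengths, and \<open>sqrt 3\<close> is the only irrationality in the coordinates.\<close>

lemma realizable_exists: "\<exists>w. realizable 3 w"
proof -
  define \<theta> :: "nat \<Rightarrow> real" where "\<theta> i = (if i = 0 then 0 else if i = 1 then pi / 2 else 2 * pi / 3)" for i
  define P where "P i = cis (\<theta> i)" for i
  have less_3: "i < 3 \<longleftrightarrow> i = 0 \<or> i = 1 \<or> i = 2" for i :: nat by auto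
  have three: "{..<3} = {0, 1, 2 :: nat}" by auto
  have "ccw_angles 3 \<theta>"
    unfolding ccw_angles_def strict_mono_on_def using pi_gt_zero by (auto simp: less_3 \<theta>_def)
  then have circ: "ccw_on_unit_circle 3 P"
    unfolding ccw_on_unit_circle_def P_def by blast
  have P: "P 0 = 1" "P 1 = \<i>" "P 2 = Complex (- 1 / 2) (sqrt 3 / 2)"
    by (simp_all add: P_def \<theta>_def cis.ctr cos_120 sin_120 complex_eq_iff)
  have mem: "z \<in> bisector 3 P i \<longleftrightarrow> z \<bullet> (P (Suc i mod 3) - P i) = 0" for i z
    unfolding bisector_def by (subst perp_bisector_through[of 0]) (simp_all add: P_def)
  \<comment> \<open>The bisectors are the lines through the origin at 45, 105 and 60
    degrees.\<close>
  have b: "z \<in> bisector 3 P 0 \<longleftrightarrow> Im z = Re z"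
     "z \<in> bisector 3 P 1 \<longleftrightarrow> (sqrt 3 - 2) * Im z = Re z"
     "z \<in> bisector 3 P 2 \<longleftrightarrow> 3 * Re z = sqrt 3 * Im z" for z
    unfolding mem by (auto simp: P inner_complex_def numeral_2_eq_2[symmetric] algebra_simps simp flip: One_nat_def)
  have "sqrt 3 < 2"
    by (rule real_less_lsqrt) simp_all
  then have s: "sqrt 3 \<noteq> 2" "sqrt 3 \<noteq> 3" "sqrt 3 \<noteq> - 1"
    using real_sqrt_gt_zero[of 3] by linarith+
  then have s': "(sqrt 3 - 2) * sqrt 3 \<noteq> - 1"
    by (simp add: left_diff_distrib)
  \<comment> \<open>\<open>Complex 1 1\<close> lies on the first bisector only; below,
    \<open>Complex (sqrt 3) 3\<close> lies on the third but not on the second.\<close>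
  have "bisector 3 P 0 \<noteq> bisector 3 P 1" "bisector 3 P 0 \<noteq> bisector 3 P 2"
    using b[of "Complex 1 1"] s by auto
  moreover have "bisector 3 P 1 \<noteq> bisector 3 P 2"
    using b(2,3)[of "Complex (sqrt 3) 3"] s by auto
  ultimately have "inj_on (bisector 3 P) {..<3}"
    unfolding three by auto
  moreover have "\<forall>i<3. \<forall>j<3. P j \<notin> bisector 3 P i"
    unfolding less_3 using s s' by (auto simp: P b simp del: One_nat_def)
  moreover have "\<forall>i<3. 1 \<notin> bisector 3 P i"
    unfolding less_3 using s by (auto simp: b simp del: One_nat_def)
  ultimately have gen: "generic 3 P"
    by (simp add: generic_def)
  obtain A B C where ABC: "scalene_triangle A B C" "circumcenter A B C = 0"
    "triangle.bisectors A B C = bisector 3 P ` {..<3}" "{A, B, C} = P ` {..<3}" "inj_on P {..<3}"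
    by (rule generic_triangle[OF circ gen])
  interpret scalene_triangle A B C by fact
  have "1 \<notin> \<Union>bisectors"
    unfolding ABC using gen by (auto simp: generic_def)
  \<comment> \<open>The word itself need not be computed: \<open>realizable_bracelet\<close>
    determines its class.\<close>
  from numbering_exists[OF this] show ?thesis
    unfolding realizable_def occupancy_word_def ABC using circ gen by blast
qed

theorem proposition2:
  "(\<forall>A B C :: complex.
      \<not> collinear {A, B, C} \<and> dist A B < dist B C \<and> dist B C < dist C A \<longrightarrow>
      (let \<R> = regions {perp_bisector A B, perp_bisector B C, perp_bisector C A};
           p = circumcenter A B C
       in card \<R> = 6 \<and>
          (\<exists>Rs. ccw_numbering p \<R> Rs) \<and>
          (\<forall>Rs. ccw_numbering p \<R> Rs \<longrightarrow>
             separated_by_empty 0 {A, B, C} Rs A B \<and>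
             separated_by_empty 1 {A, B, C} Rs B C \<and>
             separated_by_empty 2 {A, B, C} Rs C A))) \<and>
   realizable_bracelets 3 = {bracelet [0, 1, 0, 0, 1, 1]}"
proof (intro conjI allI impI)
  fix A B C :: complex
  assume "\<not> collinear {A, B, C} \<and> dist A B < dist B C \<and> dist B C < dist C A"
  then interpret scalene_triangle A B C by unfold_locales auto
  have "A \<notin> \<Union>bisectors"
    using vertex_sectors(1) unfolding sector_def by blast
  from numbering_exists[OF this] have "\<exists>Rs. ccw_numbering p (regions bisectors) Rs" by blast
  then show "let \<R> = regions {perp_bisector A B, perp_bisector B C, perp_bisector C A};
           p = circumcenter A B C
       in card \<R> = 6 \<and>
          (\<exists>Rs. ccw_numbering p \<R> Rs) \<and>
          (\<forall>Rs. ccw_numbering p \<R> Rs \<longrightarrow>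
             separated_by_empty 0 {A, B, C} Rs A B \<and>
             separated_by_empty 1 {A, B, C} Rs B C \<and>
             separated_by_empty 2 {A, B, C} Rs C A)"
    unfolding Let_def bisectors_def[symmetric] using card_regions vertices_separated by blast
next
  show "realizable_bracelets 3 = {bracelet [0, 1, 0, 0, 1, 1]}"
    unfolding realizable_bracelets_def using realizable_bracelet realizable_exists by blast
qed

end
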